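(* Let $(\Omega,\Sigma,P)$ be a probability space, let $n\ge 1$ and $t_1,\dots,t_n\ge 1$ be integers, and for each $i\in\{1,\dots,n\}$ let $\mathcal F_i=\{F_{i1},\dots,F_{it_i}\}$ be a set of events, where the events $F_{ij}$ ($1\le i\le n$, $1\le j\le t_i$) are pairwise distinct. Let $F_i=\bigcup_{j=1}^{t_i}F_{ij}$, $R=\bigcap_{i=1}^n F_i$ and $m=\sum_{i=1}^n t_i$. For $k\in\{n,n+1,\dots,m\}$ let $C_k$ be the family of all sets $\mathbf E=\{E_1,\dots,E_k\}$ of cardinality $k$ such that each $E_u=F_{i(u)j(u)}$ for some $i(u)\in\{1,\dots,n\}$ and $j(u)\in\{1,\dots,t_{i(u)}\}$, $u\in\{1,\dots,k\}$, with $\{i(1),i(2),\dots,i(k)\}=\{1,\dots,n\}$ and $E_u\neq E_v$ for $u\neq v\in\{1,\dots,k\}$. Then $$P(R)=\sum_{k=n}^m\left((-1)^{k-n}\sum_{\mathbf E\in C_k}P\left(\bigcap_{j=1}^kE_j\right)\right).$$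
   Context: $C_k$ is the family of $k$-element subsets of $\{F_{ij}: 1\le i\le n,\ 1\le j\le t_i\}$ that contain at least one element of each $\mathcal F_i$. No independence among the events $F_{ij}$ is assumed. For $\mathbf E=\{E_1,\dots,E_k\}\in C_k$, $\bigcap_{j=1}^kE_j$ is the intersection of all events in $\mathbf E$. *)

theory Defs
  imports "HOL-Probability.Probability"
begin

definition event_union :: "(nat \<Rightarrow> nat) \<Rightarrow> (nat \<Rightarrow> nat \<Rightarrow> 'a set) \<Rightarrow> nat \<Rightarrow> 'a set" where
  "event_union t F i = (\<Union>j\<in>{1..t i}. F i j)"

text \<open>
  The members of the family are unordered sets of events: \<open>E\<close> enumerates one such set without
  repetition, while \<open>a\<close> and \<open>b\<close> give the two indices of each enumerated event. Different
  enumerations of the same set yield a single member, so a sum over the family counts it once.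
\<close>

definition covering_families ::
  "nat \<Rightarrow> (nat \<Rightarrow> nat) \<Rightarrow> (nat \<Rightarrow> nat \<Rightarrow> 'a set) \<Rightarrow> nat \<Rightarrow> 'a set set set" where
  "covering_families n t F k =
    {E ` {1..k} | E a b.
       (\<forall>u\<in>{1..k}. a u \<in> {1..n} \<and> b u \<in> {1..t (a u)} \<and> E u = F (a u) (b u)) \<and>
       a ` {1..k} = {1..n} \<and>
       inj_on E {1..k}}"

end

theory Submission imports Defs begin

text \<open>
  The identity holds pointwise for indicator functions before any measure is taken. By inclusion
  and exclusion inside one row, the indicator of \<open>F\<^sub>i\<close> is
  \<open>1 - (\<Prod>j. 1 - f i j) = (\<Sum>A\<noteq>{}. (-1) ^ (card A - 1) * (\<Prod>j\<in>A. f i j))\<close>, where \<open>f i j\<close> is the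
  indicator of \<open>F i j\<close>. The indicator of \<open>R\<close> is the product of these over \<open>i\<close>. Multiplying out
  means choosing one nonempty set of column indices in every row, and such a choice is the same
  thing as a set \<open>T\<close> of index pairs that meets every row. The \<open>n\<close> rows contribute the total sign
  \<open>(-1) ^ (card T - n)\<close>, which gives the polynomial identity \<open>prod_one_minus_prod_one_minus\<close>.

  Since the product of the indicators over \<open>T\<close> is the indicator of the intersection, integrating
  yields \<open>measure_INT_UN_eq_sum_covering\<close> by linearity. What remains is to sort the sets \<open>T\<close> by
  cardinality and to pass from sets of indices to sets of events
  (\<open>covering_families_eq_image\<close>). As distinct indices name distinct events, no two index sets give
  the same set of events.
\<close>

lemma one_minus_prod_one_minus:
  fixes f :: "'b \<Rightarrow> 'c::comm_ring_1"
  assumes "finite J"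
  shows "1 - (\<Prod>j\<in>J. 1 - f j) = (\<Sum>A\<in>Pow J - {{}}. (-1) ^ (card A + 1) * prod f A)"
proof -
  have "(\<Prod>j\<in>J. 1 - f j) = (\<Sum>A\<in>Pow J. (-1) ^ card A * prod f A)"
    using prod_diff_conv_sum[OF assms, of "\<lambda>_. 1" f] by simp
  also have "\<dots> = 1 + (\<Sum>A\<in>Pow J - {{}}. (-1) ^ card A * prod f A)"
    using assms by (subst sum.remove[of _ "{}"]) auto
  finally show ?thesis
    by (simp add: sum_negf)
qed

text \<open>
  Expanding a product of sums produces choice functions, whereas the theorem sums over sets that
  meet every row. The graph construction \<open>Sigma I\<close> translates between the two; that each chosen set
  is nonempty corresponds to the projection being all of \<open>I\<close>.
\<close>

lemma bij_betw_Sigma_PiE_covering: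
  "bij_betw (Sigma I) (PiE I (\<lambda>i. Pow (J i) - {{}})) {T. T \<subseteq> Sigma I J \<and> fst ` T = I}"
  (is "bij_betw _ (PiE I ?P) ?C")
proof (rule bij_betw_byWitness[where f' = "\<lambda>T. \<lambda>i\<in>I. T `` {i}"])
  show "\<forall>g\<in>PiE I ?P. (\<lambda>i\<in>I. Sigma I g `` {i}) = g"
  proof
    fix g assume g: "g \<in> PiE I ?P"
    have "Sigma I g `` {i} = g i" if "i \<in> I" for i
      using that by blast
    then have "(\<lambda>i\<in>I. Sigma I g `` {i}) = restrict g I"
      by (rule restrict_ext)
    also have "\<dots> = g"
      using g by (simp add: PiE_restrict)
    finally show "(\<lambda>i\<in>I. Sigma I g `` {i}) = g" .
  qed
  show "\<forall>T\<in>?C. Sigma I (\<lambda>i\<in>I. T `` {i}) = T"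
  proof
    fix T assume T: "T \<in> ?C"
    then have "i \<in> I" if "(i, j) \<in> T" for i j
      using that by blast
    then show "Sigma I (\<lambda>i\<in>I. T `` {i}) = T"
      by auto
  qed
  show "Sigma I ` PiE I ?P \<subseteq> ?C"
  proof (intro image_subsetI CollectI conjI)
    fix g assume "g \<in> PiE I ?P"
    then have g: "g i \<subseteq> J i" "g i \<noteq> {}" if "i \<in> I" for i
      using that by (auto dest: PiE_mem)
    show "Sigma I g \<subseteq> Sigma I J"
      using g(1) by (rule Sigma_mono[OF order_refl])
    show "fst ` Sigma I g = I"
      using g(2) by (simp add: fst_image_Sigma) blast
  qed
  show "(\<lambda>T. \<lambda>i\<in>I. T `` {i}) ` ?C \<subseteq> PiE I ?P"
  proof (intro image_subsetI PiE_I)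
    fix T i assume "T \<in> ?C" "i \<in> I"
    then have "T \<subseteq> Sigma I J" "i \<in> fst ` T"
      by blast+
    then show "(\<lambda>i\<in>I. T `` {i}) i \<in> ?P i"
      using \<open>i \<in> I\<close> by auto
  qed simp
qed

text \<open>
  With \<open>f\<close> a 0-1-valued indicator, the left-hand side is the indicator of an intersection of
  unions. No variable occurs in two different factors, so every choice of one monomial
  per row yields a squarefree monomial, and distinct choices yield distinct ones.
\<close>

lemma prod_one_minus_prod_one_minus:
  fixes f :: "'b \<times> 'c \<Rightarrow> 'd::comm_ring_1"
  assumes "finite I" and "\<And>i. i \<in> I \<Longrightarrow> finite (J i)"
  shows "(\<Prod>i\<in>I. 1 - (\<Prod>j\<in>J i. 1 - f (i, j))) =
    (\<Sum>T | T \<subseteq> Sigma I J \<and> fst ` T = I. (-1) ^ (card T - card I) * prod f T)"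
proof -
  let ?P = "\<lambda>i. Pow (J i) - {{}}"
  have "(\<Prod>i\<in>I. 1 - (\<Prod>j\<in>J i. 1 - f (i, j))) =
      (\<Prod>i\<in>I. \<Sum>A\<in>?P i. (-1) ^ (card A + 1) * (\<Prod>j\<in>A. f (i, j)))"
    using assms(2) by (intro prod.cong refl one_minus_prod_one_minus)
  also have "\<dots> = (\<Sum>g\<in>PiE I ?P. \<Prod>i\<in>I. (-1) ^ (card (g i) + 1) * (\<Prod>j\<in>g i. f (i, j)))"
    using assms by (intro prod_sum_PiE) auto
  also have "\<dots> = (\<Sum>g\<in>PiE I ?P. (-1) ^ (card (Sigma I g) - card I) * prod f (Sigma I g))"
  proof (rule sum.cong[OF refl])
    fix g assume g: "g \<in> PiE I ?P"
    have fin: "finite (g i)" "g i \<noteq> {}" if "i \<in> I" for i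
      using g assms(2)[OF that] that by (auto simp: PiE_def Pi_def intro: finite_subset)
    have card: "card (Sigma I g) = (\<Sum>i\<in>I. card (g i))"
      using assms(1) fin by (intro card_SigmaI) auto
    \<comment> \<open>The subtraction in the exponent is harmless because every row contributes at least one pair.\<close>
    have ge: "card I \<le> card (Sigma I g)"
      unfolding card card_eq_sum[of I] using fin
      by (intro sum_mono) (simp add: Suc_le_eq card_gt_0_iff)
    have "(\<Prod>i\<in>I. (-1) ^ (card (g i) + 1) * (\<Prod>j\<in>g i. f (i, j))) =
        (\<Prod>i\<in>I. (-1) ^ (card (g i) + 1)) * (\<Prod>i\<in>I. \<Prod>j\<in>g i. f (i, j))"
      by (rule prod.distrib)
    also have "(\<Prod>i\<in>I. (-1) ^ (card (g i) + 1)) = (-1 :: 'd) ^ (card (Sigma I g) + card I)"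
      by (simp only: power_sum[symmetric] sum.distrib card card_eq_sum[of I, symmetric])
    also have "(-1 :: 'd) ^ (card (Sigma I g) + card I) = (-1) ^ (card (Sigma I g) - card I)"
      using ge by (rule neg_one_power_add_eq_neg_one_power_diff)
    also have "(\<Prod>i\<in>I. \<Prod>j\<in>g i. f (i, j)) = prod f (Sigma I g)"
      using assms(1) fin by (subst prod.Sigma) auto
    finally show "(\<Prod>i\<in>I. (-1) ^ (card (g i) + 1) * (\<Prod>j\<in>g i. f (i, j))) =
        (-1) ^ (card (Sigma I g) - card I) * prod f (Sigma I g)" .
  qed
  also have "\<dots> = (\<Sum>T | T \<subseteq> Sigma I J \<and> fst ` T = I. (-1) ^ (card T - card I) * prod f T)"
    by (rule sum.reindex_bij_betw[OF bij_betw_Sigma_PiE_covering])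
  finally show ?thesis .
qed

text \<open>
  The indices \<open>a u\<close> and \<open>b u\<close> of an enumeration trace out the index set \<open>T\<close>, and any enumeration of
  \<open>T\<close> gives one of the events. Injectivity is what makes \<open>k\<close> distinct events correspond to exactly
  \<open>k\<close> distinct index pairs.
\<close>

lemma covering_families_eq_image:
  assumes "inj_on (\<lambda>(i, j). F i j) (SIGMA i:{1..n}. {1..t i})"
  shows "covering_families n t F k =
    image (\<lambda>(i, j). F i j) `
      {T. T \<subseteq> (SIGMA i:{1..n}. {1..t i}) \<and> fst ` T = {1..n} \<and> card T = k}"
    (is "_ = image ?G ` ?C")
proof (intro equalityI subsetI)
  fix X assume "X \<in> covering_families n t F k"
  then obtain E a b where X: "X = E ` {1..k}"
    and ab: "\<forall>u\<in>{1..k}. a u \<in> {1..n} \<and> b u \<in> {1..t (a u)} \<and> E u = F (a u) (b u)"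
    and a: "a ` {1..k} = {1..n}" and E: "inj_on E {1..k}"
    unfolding covering_families_def mem_Collect_eq by (elim exE conjE) (rule that)
  let ?T = "(\<lambda>u. (a u, b u)) ` {1..k}"
  have "inj_on (\<lambda>u. (a u, b u)) {1..k}"
    using E ab by (intro inj_onI) (metis inj_onD prod.inject)
  then have "card ?T = k"
    by (simp add: card_image)
  moreover have "fst ` ?T = {1..n}"
    using a by (simp add: image_image)
  moreover have "?T \<subseteq> (SIGMA i:{1..n}. {1..t i})"
    using ab by blast
  moreover have "X = ?G ` ?T"
    unfolding X image_image using ab by (intro image_cong refl) simp
  ultimately show "X \<in> image ?G ` ?C"
    by blast
next
  fix X assume "X \<in> image ?G ` ?C"
  then obtain T where X: "X = ?G ` T" and T: "T \<subseteq> (SIGMA i:{1..n}. {1..t i})"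
    "fst ` T = {1..n}" "card T = k"
    by blast
  have "finite T"
    using T(1) by (rule finite_subset) auto
  with T(3) obtain h where h: "bij_betw h {1..k} T"
    using ex_bij_betw_nat_finite_1 by blast
  then have hT: "h ` {1..k} = T"
    by (simp add: bij_betw_def)
  show "X \<in> covering_families n t F k"
    unfolding covering_families_def mem_Collect_eq
  proof (rule exI[of _ "?G \<circ> h"], rule exI[of _ "fst \<circ> h"], rule exI[of _ "snd \<circ> h"],
      intro conjI)
    show "X = (?G \<circ> h) ` {1..k}" "(fst \<circ> h) ` {1..k} = {1..n}"
      by (simp_all only: image_comp[symmetric] hT T(2) X)
    show "inj_on (?G \<circ> h) {1..k}"
      using h T(1) assms by (auto simp: bij_betw_def intro!: comp_inj_on intro: inj_on_subset)
    show "\<forall>u\<in>{1..k}. (fst \<circ> h) u \<in> {1..n} \<and> (snd \<circ> h) u \<in> {1..t ((fst \<circ> h) u)} \<and>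
        (?G \<circ> h) u = F ((fst \<circ> h) u) ((snd \<circ> h) u)"
      using hT T(1) by (force simp: case_prod_unfold)
  qed
qed

lemma indicator_UN_eq_one_minus_prod:
  assumes "finite J"
  shows "(indicator (\<Union>j\<in>J. A j) x :: 'c::comm_ring_1) = 1 - (\<Prod>j\<in>J. 1 - indicator (A j) x)"
proof (cases "x \<in> (\<Union>j\<in>J. A j)")
  case True
  then have "(\<Prod>j\<in>J. 1 - indicator (A j) x) = (0 :: 'c)"
    using assms by (auto intro!: prod_zero simp: indicator_def)
  with True show ?thesis by simp
qed (simp add: indicator_def)

lemma indicator_INT_eq_prod:
  assumes "finite J"
  shows "(indicator (\<Inter>j\<in>J. A j) x :: 'c::comm_semiring_1) = (\<Prod>j\<in>J. indicator (A j) x)"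
proof (cases "x \<in> (\<Inter>j\<in>J. A j)")
  case False
  then have "(\<Prod>j\<in>J. indicator (A j) x) = (0 :: 'c)"
    using assms by (auto intro!: prod_zero simp: indicator_def)
  with False show ?thesis by simp
qed simp

text \<open>
  The families are indexed by sets of pairs \<open>T\<close> instead of sets of events, so the formula is valid
  even if some events coincide. The assumption \<open>I \<noteq> {}\<close> keeps the intersections over \<open>I\<close> and \<open>T\<close>
  from degenerating to \<open>UNIV\<close>, which need not be a measurable set.
\<close>

lemma (in finite_measure) measure_INT_UN_eq_sum_covering:
  assumes "finite I" and "I \<noteq> {}" and "\<And>i. i \<in> I \<Longrightarrow> finite (J i)"
    and "\<And>s. s \<in> Sigma I J \<Longrightarrow> G s \<in> sets M"
  shows "measure M (\<Inter>i\<in>I. \<Union>j\<in>J i. G (i, j)) =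
    (\<Sum>T | T \<subseteq> Sigma I J \<and> fst ` T = I. (-1) ^ (card T - card I) * measure M (\<Inter>s\<in>T. G s))"
    (is "measure M ?R = (\<Sum>T\<in>?C. _)")
proof -
  have finT: "finite T" if "T \<in> ?C" for T
    using that assms(1,3) by (auto intro: finite_subset finite_SigmaI)
  have setsT: "(\<Inter>s\<in>T. G s) \<in> sets M" if "T \<in> ?C" for T
  proof (rule sets.finite_INT[OF finT[OF that]])
    show "T \<noteq> {}"
      using that assms(2) by blast
    show "G s \<in> sets M" if "s \<in> T" for s
      using that \<open>T \<in> ?C\<close> assms(4) by blast
  qed
  have setsR: "?R \<in> sets M"
    using assms by (intro sets.finite_INT sets.finite_UN) (simp_all add: mem_Sigma_iff)
  have ind: "indicator ?R x =
      (\<Sum>T\<in>?C. (-1) ^ (card T - card I) * indicator (\<Inter>s\<in>T. G s) x :: real)" for x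
  proof -
    have "indicator ?R x = (\<Prod>i\<in>I. 1 - (\<Prod>j\<in>J i. 1 - indicator (G (i, j)) x) :: real)"
      using assms(1,3) by (simp add: indicator_INT_eq_prod indicator_UN_eq_one_minus_prod)
    also have "\<dots> = (\<Sum>T\<in>?C. (-1) ^ (card T - card I) * (\<Prod>s\<in>T. indicator (G s) x))"
      using assms(1,3) by (rule prod_one_minus_prod_one_minus)
    also have "\<dots> = (\<Sum>T\<in>?C. (-1) ^ (card T - card I) * indicator (\<Inter>s\<in>T. G s) x)"
      using finT by (intro sum.cong refl) (simp add: indicator_INT_eq_prod)
    finally show ?thesis .
  qed
  have "measure M ?R = (\<integral>x. indicator ?R x \<partial>M)"
    using setsR by simp
  also have "\<dots> = (\<integral>x. (\<Sum>T\<in>?C. (-1) ^ (card T - card I) * indicator (\<Inter>s\<in>T. G s) x) \<partial>M)"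
    by (simp only: ind)
  also have "\<dots> = (\<Sum>T\<in>?C. \<integral>x. (-1) ^ (card T - card I) * indicator (\<Inter>s\<in>T. G s) x \<partial>M)"
    using setsT by (intro Bochner_Integration.integral_sum integrable_mult_right) 
      (simp add: integrable_indicator_iff emeasure_finite less_top[symmetric])
  also have "\<dots> = (\<Sum>T\<in>?C. (-1) ^ (card T - card I) * measure M (\<Inter>s\<in>T. G s))"
    using setsT by (intro sum.cong refl) simp
  finally show ?thesis .
qed

theorem proposition1:
  fixes M :: "'a measure" and n m :: nat and t :: "nat \<Rightarrow> nat"
    and F :: "nat \<Rightarrow> nat \<Rightarrow> 'a set" and R :: "'a set"
  assumes "prob_space M"
    and "n \<ge> 1"
    and "\<And>i. i \<in> {1..n} \<Longrightarrow> t i \<ge> 1"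
    and "\<And>i j. i \<in> {1..n} \<Longrightarrow> j \<in> {1..t i} \<Longrightarrow> F i j \<in> sets M"
    and "inj_on (\<lambda>(i, j). F i j) (SIGMA i:{1..n}. {1..t i})"
    and "R = (\<Inter>i\<in>{1..n}. event_union t F i)"
    and "m = (\<Sum>i=1..n. t i)"
  shows "measure M R =
    (\<Sum>k=n..m. (-1) ^ (k - n) * (\<Sum>\<E>\<in>covering_families n t F k. measure M (\<Inter>\<E>)))"
proof -
  interpret prob_space M by fact
  let ?S = "SIGMA i:{1..n}. {1..t i}" and ?G = "\<lambda>(i, j). F i j"
  let ?C = "{T. T \<subseteq> ?S \<and> fst ` T = {1..n}}"
  have finS: "finite ?S"
    by simp
  have cardS: "card ?S = m"
    by (simp add: assms(7))
  have events_G: "?G s \<in> sets M" if "s \<in> ?S" for s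
    using that assms(4) by auto
  have finC: "finite ?C"
    by (rule finite_subset[of _ "Pow ?S"]) auto
  have card_range: "card T \<in> {n..m}" if "T \<in> ?C" for T
  proof -
    have "finite T"
      using that finite_subset[OF _ finS] by blast
    then have "card (fst ` T) \<le> card T"
      by (rule card_image_le)
    moreover have "card T \<le> m"
      using that card_mono[OF finS] cardS by auto
    ultimately show ?thesis
      using that by simp
  qed
  have "measure M R =
      (\<Sum>T\<in>?C. (-1) ^ (card T - n) * measure M (\<Inter>(?G ` T)))"
    using measure_INT_UN_eq_sum_covering[of "{1..n}" "\<lambda>i. {1..t i}" ?G, OF _ _ _ events_G] assms(2)
    by (simp add: assms(6) event_union_def)
  also have "\<dots> = (\<Sum>k=n..m. \<Sum>T | T \<in> ?C \<and> card T = k.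
      (-1) ^ (card T - n) * measure M (\<Inter>(?G ` T)))"
    using finC card_range by (intro sum.group[symmetric]) auto
  also have "\<dots> = (\<Sum>k=n..m. (-1) ^ (k - n) *
      (\<Sum>\<E>\<in>covering_families n t F k. measure M (\<Inter>\<E>)))"
  proof (rule sum.cong[OF refl])
    fix k
    let ?D = "{T. T \<subseteq> ?S \<and> fst ` T = {1..n} \<and> card T = k}"
    have "inj_on (image ?G) ?D"
      using assms(5) by (intro inj_on_image) (rule inj_on_subset, auto)
    then have "(\<Sum>\<E>\<in>covering_families n t F k. measure M (\<Inter>\<E>)) =
        (\<Sum>T\<in>?D. measure M (\<Inter>(?G ` T)))"
      by (simp add: covering_families_eq_image[OF assms(5)] sum.reindex)
    then show "(\<Sum>T | T \<in> ?C \<and> card T = k. (-1) ^ (card T - n) * measure M (\<Inter>(?G ` T))) =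
        (-1) ^ (k - n) * (\<Sum>\<E>\<in>covering_families n t F k. measure M (\<Inter>\<E>))"
      by (simp add: sum_distrib_left conj_assoc)
  qed
  finally show ?thesis .
qed

end
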